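(* Let $K\subset\mathbb{C}$ be an arbitrary non-empty compact set, let $(\Omega,\mathcal A)$ be a measurable space, and let $f:\Omega\times K\to\mathbb{C}$ be a random function on $K$. Suppose that, for each $\omega\in\Omega$, there exist an open neighborhood $U_\omega$ of $K$ and a function $g_\omega$ holomorphic on $U_\omega$ such that $g_\omega|_K=f(\omega,\cdot)$. Then there is a sequence $r_j(\omega,z)$ of random rational functions, pole-free on $K$, such that, for each $\omega\in\Omega$, $r_j(\omega,\cdot)\to f(\omega,\cdot)$ uniformly on $K$ as $j\to\infty$.
   Context: Measurability of complex-valued functions is with respect to the Borel $\sigma$-algebra on $\mathbb{C}$. A function $f:\Omega\times K\to\mathbb{C}$ is a random function on $K$ if $f(\cdot,z)$ is measurable on $(\Omega,\mathcal A)$ for each $z\in K$. A random rational function pole-free on $K$ is a random function $r:\Omega\times K\to\mathbb{C}$ such that, for each $\omega\in\Omega$, $r(\omega,\cdot)$ is (the restriction to $K$ of) a rational function with no poles on $K$. *)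

theory Defs
  imports "HOL-Complex_Analysis.Complex_Analysis" "HOL-Computational_Algebra.Polynomial"
begin

text \<open>
  A measurable space is represented by a value \<open>M\<close> of type \<open>'w measure\<close>, of which only
  \<open>space M\<close> and \<open>sets M\<close> are used; the measure itself plays no role. A function on
  \<open>space M \<times> K\<close> is a curried total function whose values off \<open>space M \<times> K\<close> are irrelevant.
\<close>

definition random_function ::
    "'w measure \<Rightarrow> complex set \<Rightarrow> ('w \<Rightarrow> complex \<Rightarrow> complex) \<Rightarrow> bool" where
  "random_function M K f \<longleftrightarrow> (\<forall>z\<in>K. (\<lambda>\<omega>. f \<omega> z) \<in> borel_measurable M)"

text \<open>
  The poles of a rational function are the zeros of its denominator in lowest terms, hence
  the coprimality condition. Only the values of \<open>h\<close> on \<open>K\<close> are constrained.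
\<close>

definition rational_pole_free_on :: "complex set \<Rightarrow> (complex \<Rightarrow> complex) \<Rightarrow> bool" where
  "rational_pole_free_on K h \<longleftrightarrow>
     (\<exists>p q :: complex poly. q \<noteq> 0 \<and> coprime p q \<and>
        (\<forall>z\<in>K. poly q z \<noteq> 0) \<and> (\<forall>z\<in>K. h z = poly p z / poly q z))"

definition random_rational_function_pole_free ::
    "'w measure \<Rightarrow> complex set \<Rightarrow> ('w \<Rightarrow> complex \<Rightarrow> complex) \<Rightarrow> bool" where
  "random_rational_function_pole_free M K r \<longleftrightarrow>
     random_function M K r \<and> (\<forall>\<omega>\<in>space M. rational_pole_free_on K (r \<omega>))"

end

theory Submission
  imports Defs
begin

text \<open>
  Fix a countable dense set \<open>D\<close> of complex numbers. Functions holomorphic near \<open>K\<close> are uniform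
  limits on \<open>K\<close> of the countably many functions \<open>\<Sum> c / (w - z)\<close> with \<open>c \<in> D\<close> and
  \<open>w \<in> D - K\<close> (Runge): on a fine square grid, Cauchy's formula summed over the cells meeting
  \<open>K\<close> leaves only integrals over edges off \<open>K\<close>, which are limits of Riemann sums. Enumerating
  the family as \<open>q 0, q 1, \<dots>\<close>, let \<open>r j \<omega> = q k\<close> for the least \<open>k\<close> such that
  \<open>q k\<close> is within \<open>1 / (j + 1)\<close> of \<open>f \<omega>\<close> on \<open>K\<close>. This choice is measurable because, by
  continuity, closeness on \<open>K\<close> need only be tested on a countable dense subset of \<open>K\<close>.
\<close>

section \<open>Finite sums of simple poles\<close>

text \<open>Lists serve twice: concatenation is addition of the functions, and the lists over a
  countable set of coefficients and poles form a countable family.\<close>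

definition pole_sum :: "(complex \<times> complex) list \<Rightarrow> complex \<Rightarrow> complex" where
  "pole_sum xs z = (\<Sum>(c, w)\<leftarrow>xs. c / (w - z))"

definition pole_sum_approximable ::
    "complex set \<Rightarrow> complex set \<Rightarrow> (complex \<Rightarrow> complex) \<Rightarrow> bool" where
  "pole_sum_approximable D K h \<longleftrightarrow>
     (\<forall>e>0. \<exists>xs\<in>lists (D \<times> (D - K)). \<forall>z\<in>K. norm (h z - pole_sum xs z) < e)"

text \<open>A denominator without zeros on \<open>K\<close> suffices, and lowest terms come by
  induction on its degree. A common non-unit factor \<open>d\<close> has no zeros on
  \<open>K\<close> either, so cancelling it keeps the values there and lowers the degree.
  Non-emptiness of \<open>K\<close> rules out \<open>q = 0\<close>.\<close>

lemma rational_pole_free_onI: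
  assumes "K \<noteq> {}" "\<And>z. z \<in> K \<Longrightarrow> poly q z \<noteq> 0" "\<And>z. z \<in> K \<Longrightarrow> h z = poly p z / poly q z"
  shows "rational_pole_free_on K h"
  using assms(2,3)
proof (induction "degree q" arbitrary: p q rule: less_induct)
  case less
  have "q \<noteq> 0"
    using assms(1) less.prems(1) by auto
  show ?case
  proof (cases "coprime p q")
    case True
    then show ?thesis
      unfolding rational_pole_free_on_def using \<open>q \<noteq> 0\<close> less.prems by blast
  next
    case False
    then obtain d where d: "d dvd p" "d dvd q" "\<not> is_unit d"
      unfolding coprime_def by blast
    then obtain p' q' where pq: "p = d * p'" "q = d * q'"
      by (elim dvdE)
    have "d \<noteq> 0" "q' \<noteq> 0"
      using \<open>q \<noteq> 0\<close> pq(2) by auto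
    then have "degree q' < degree q"
      using d(3) by (simp add: pq(2) degree_mult_eq is_unit_iff_degree)
    then show ?thesis
    proof (rule less.hyps)
      fix z assume "z \<in> K"
      with less.prems show "poly q' z \<noteq> 0" "h z = poly p' z / poly q' z"
        by (auto simp: pq)
    qed
  qed
qed

lemma pole_sum_rational:
  assumes "xs \<in> lists (UNIV \<times> (- K))"
  shows "\<exists>p q. \<forall>z\<in>K. poly q z \<noteq> 0 \<and> pole_sum xs z = poly p z / poly q z"
  using assms
proof (induction rule: lists.induct)
  case Nil
  then show ?case
    by (intro exI[of _ 0] exI[of _ 1]) (simp add: pole_sum_def)
next
  case (Cons x xs)
  then obtain p q where pq: "\<And>z. z \<in> K \<Longrightarrow> poly q z \<noteq> 0 \<and> pole_sum xs z = poly p z / poly q z"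
    by auto
  obtain c w where x: "x = (c, w)" "w \<notin> K"
    using Cons.hyps(1) by (cases x) auto
  have "poly (q * [:w, -1:]) z \<noteq> 0 \<and>
        pole_sum (x # xs) z = poly (smult c q + p * [:w, -1:]) z / poly (q * [:w, -1:]) z"
    if "z \<in> K" for z
  proof -
    have "w - z \<noteq> 0" "poly q z \<noteq> 0" "pole_sum xs z = poly p z / poly q z"
      using x that pq by auto
    then show ?thesis
      by (simp add: x pole_sum_def field_simps)
  qed
  then show ?case
    by blast
qed

lemma pole_sum_pole_free:
  assumes "K \<noteq> {}" "xs \<in> lists (UNIV \<times> (- K))"
  shows "rational_pole_free_on K (pole_sum xs)"
proof -
  obtain p q where "\<forall>z\<in>K. poly q z \<noteq> 0 \<and> pole_sum xs z = poly p z / poly q z"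
    using pole_sum_rational[OF assms(2)] by blast
  then show ?thesis
    by (intro rational_pole_free_onI[OF assms(1), of q _ p]) simp_all
qed

lemma pole_sum_append: "pole_sum (xs @ ys) z = pole_sum xs z + pole_sum ys z"
  by (simp add: pole_sum_def)

lemma continuous_on_pole_sum:
  assumes "xs \<in> lists (UNIV \<times> (- K))"
  shows "continuous_on K (pole_sum xs)"
proof -
  obtain p q where pq: "\<And>z. z \<in> K \<Longrightarrow> poly q z \<noteq> 0 \<and> pole_sum xs z = poly p z / poly q z"
    using pole_sum_rational[OF assms] by auto
  then have "continuous_on K (\<lambda>z. poly p z / poly q z)"
    by (intro continuous_intros) auto
  then show ?thesis
    using pq by (simp cong: continuous_on_cong)
qed

section \<open>Closure properties of the approximable functions\<close>

lemma pole_sum_approximable_zero: "pole_sum_approximable D K (\<lambda>z. 0)"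
  unfolding pole_sum_approximable_def
  by (auto intro!: bexI[of _ "[]"] simp: pole_sum_def)

lemma pole_sum_approximable_add:
  assumes "pole_sum_approximable D K g" "pole_sum_approximable D K h"
  shows "pole_sum_approximable D K (\<lambda>z. g z + h z)"
  unfolding pole_sum_approximable_def
proof (intro allI impI)
  fix e :: real assume "e > 0"
  then have "e / 2 > 0"
    by simp
  obtain xs where xs: "xs \<in> lists (D \<times> (D - K))" "\<And>z. z \<in> K \<Longrightarrow> norm (g z - pole_sum xs z) < e / 2"
    using assms(1)[unfolded pole_sum_approximable_def, rule_format, OF \<open>e / 2 > 0\<close>] by (elim bexE) simp
  obtain ys where ys: "ys \<in> lists (D \<times> (D - K))" "\<And>z. z \<in> K \<Longrightarrow> norm (h z - pole_sum ys z) < e / 2"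
    using assms(2)[unfolded pole_sum_approximable_def, rule_format, OF \<open>e / 2 > 0\<close>] by (elim bexE) simp
  have "norm (g z + h z - pole_sum (xs @ ys) z) < e" if "z \<in> K" for z
  proof -
    have "norm (g z + h z - (pole_sum xs z + pole_sum ys z)) < e / 2 + e / 2"
      using norm_diff_triangle_ineq add_strict_mono[OF xs(2)[OF that] ys(2)[OF that]]
      by (rule order_le_less_trans)
    then show ?thesis
      unfolding pole_sum_append by simp
  qed
  moreover have "xs @ ys \<in> lists (D \<times> (D - K))"
    unfolding append_in_lists_conv using xs(1) ys(1) by (rule conjI)
  ultimately show "\<exists>zs\<in>lists (D \<times> (D - K)). \<forall>z\<in>K. norm (g z + h z - pole_sum zs z) < e"
    by blast
qed

lemma pole_sum_approximable_sum_list: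
  assumes "\<And>x. x \<in> set xs \<Longrightarrow> pole_sum_approximable D K (h x)"
  shows "pole_sum_approximable D K (\<lambda>z. \<Sum>x\<leftarrow>xs. h x z)"
  using assms
proof (induction xs)
  case (Cons x xs)
  then have "pole_sum_approximable D K (h x)" "pole_sum_approximable D K (\<lambda>z. \<Sum>x\<leftarrow>xs. h x z)"
    by simp_all
  from pole_sum_approximable_add[OF this] show ?case
    by simp
qed (simp add: pole_sum_approximable_zero)

lemma pole_sum_approximable_sum:
  assumes "\<And>i. i \<in> I \<Longrightarrow> pole_sum_approximable D K (h i)"
  shows "pole_sum_approximable D K (\<lambda>z. \<Sum>i\<in>I. h i z)"
  using assms
proof (induction I rule: infinite_finite_induct)
  case (insert i I)
  then have "pole_sum_approximable D K (h i)" "pole_sum_approximable D K (\<lambda>z. \<Sum>i\<in>I. h i z)"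
    by simp_all
  from pole_sum_approximable_add[OF this] show ?case
    using insert.hyps by simp
qed (simp_all add: pole_sum_approximable_zero)

lemma pole_sum_approximable_limit:
  assumes "\<And>e. e > 0 \<Longrightarrow>
    \<exists>g. pole_sum_approximable D K g \<and> (\<forall>z\<in>K. norm (h z - g z) < e)"
  shows "pole_sum_approximable D K h"
  unfolding pole_sum_approximable_def
proof (intro allI impI)
  fix e :: real assume "e > 0"
  then have e2: "e / 2 > 0"
    by simp
  obtain g where g: "pole_sum_approximable D K g" "\<And>z. z \<in> K \<Longrightarrow> norm (h z - g z) < e / 2"
    using assms[OF e2] by blast
  obtain xs where xs: "xs \<in> lists (D \<times> (D - K))" "\<And>z. z \<in> K \<Longrightarrow> norm (g z - pole_sum xs z) < e / 2"
    using g(1)[unfolded pole_sum_approximable_def, rule_format, OF e2] by (elim bexE) simp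
  have "norm (h z - pole_sum xs z) < e" if "z \<in> K" for z
    using norm_diff_triangle_less[OF g(2)[OF that] xs(2)[OF that]] by simp
  then show "\<exists>xs\<in>lists (D \<times> (D - K)). \<forall>z\<in>K. norm (h z - pole_sum xs z) < e"
    using xs(1) by blast
qed

text \<open>Coefficient and pole are moved to nearby points of \<open>D\<close>. This perturbs the
  function uniformly little on \<open>K\<close>, because \<open>w - z\<close> is bounded away from
  zero there by compactness.\<close>

lemma pole_sum_approximable_pole:
  assumes "compact K" "closure D = UNIV" "w \<notin> K"
  shows "pole_sum_approximable D K (\<lambda>z. c / (w - z))"
proof -
  have "open (- K)"
    using assms(1) compact_imp_closed by blast
  \<comment> \<open>Since the complement of \<open>K\<close> is open, density of \<open>D\<close>
    survives intersection with it, so the approximating poles can be taken off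
    \<open>K\<close>.\<close>
  then have "w \<in> closure (- K \<inter> D)"
    using open_Int_closure_subset[of "- K" D] assms(2,3) by auto
  then obtain ws where ws: "\<And>n. ws n \<in> - K \<inter> D" "ws \<longlonglongrightarrow> w"
    unfolding closure_sequential by blast
  obtain cs where cs: "\<And>n. cs n \<in> D" "cs \<longlonglongrightarrow> c"
    using assms(2) closure_sequential[of c D] by auto
  obtain d where d: "d > 0" "\<And>z. z \<in> K \<Longrightarrow> d \<le> dist w z"
    using separate_point_closed[of K w] assms compact_imp_closed by blast
  have const: "uniform_limit K (\<lambda>n z. a n) (\<lambda>z. l) sequentially"
    if "a \<longlonglongrightarrow> l" for a :: "nat \<Rightarrow> complex" and l
    using that by (intro uniform_limitI) (auto dest: tendstoD)
  have lim: "uniform_limit K (\<lambda>n z. cs n / (ws n - z)) (\<lambda>z. c / (w - z)) sequentially"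
  proof (rule uniform_lim_divide)
    show "uniform_limit K (\<lambda>n z. cs n) (\<lambda>z. c) sequentially"
      using cs(2) by (rule const)
    show "uniform_limit K (\<lambda>n z. ws n - z) (\<lambda>z. w - z) sequentially"
      by (intro uniform_limit_minus const[OF ws(2)] uniform_limit_const)
    show "bounded ((\<lambda>z. c) ` K)"
      by (auto intro: finite_imp_bounded finite_subset[of _ "{c}"])
    show "d \<le> norm (w - z)" if "z \<in> K" for z
      using d(2)[OF that] by (simp add: dist_norm)
  qed (use d in auto)
  show ?thesis
    unfolding pole_sum_approximable_def
  proof (intro allI impI)
    fix e :: real assume "e > 0"
    obtain n where n: "\<forall>z\<in>K. dist (cs n / (ws n - z)) (c / (w - z)) < e"
      using eventually_happens[OF uniform_limitD[OF lim \<open>e > 0\<close>]] by auto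
    then have "\<forall>z\<in>K. norm (c / (w - z) - pole_sum [(cs n, ws n)] z) < e"
      by (simp add: pole_sum_def dist_norm norm_minus_commute)
    moreover have "[(cs n, ws n)] \<in> lists (D \<times> (D - K))"
      using cs(1)[of n] ws(1)[of n] by simp
    ultimately show "\<exists>xs\<in>lists (D \<times> (D - K)). \<forall>z\<in>K. norm (c / (w - z) - pole_sum xs z) < e"
      by blast
  qed
qed

section \<open>Uniform Riemann sums and integrals of the Cauchy kernel\<close>

lemma riemann_sum_uniform:
  fixes \<phi> :: "real \<Rightarrow> 'a::metric_space \<Rightarrow> 'b::euclidean_space"
  assumes "compact K" "continuous_on ({0..1} \<times> K) (\<lambda>(t, z). \<phi> t z)" "e > 0"
  obtains n :: nat where "n > 0"
    "\<And>z. z \<in> K \<Longrightarrow>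
       norm (integral {0..1} (\<lambda>t. \<phi> t z) - (\<Sum>k<n. (1 / n) *\<^sub>R \<phi> (k / n) z)) \<le> e"
proof -
  \<comment> \<open>Compactness of the product provides one mesh width that serves all
    \<open>z\<close> in \<open>K\<close> at once.\<close>
  have "uniformly_continuous_on ({0..1} \<times> K) (\<lambda>(t, z). \<phi> t z)"
    using assms(1,2) by (intro compact_uniformly_continuous compact_Times) auto
  then obtain d where d: "d > 0"
    "\<And>x y. x \<in> {0..1} \<times> K \<Longrightarrow> y \<in> {0..1} \<times> K \<Longrightarrow> dist y x < d \<Longrightarrow>
       dist ((\<lambda>(t, z). \<phi> t z) y) ((\<lambda>(t, z). \<phi> t z) x) < e"
    using assms(3) unfolding uniformly_continuous_on_def by metis
  have close: "norm (\<phi> s z - \<phi> t z) \<le> e"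
    if "z \<in> K" "s \<in> {0..1}" "t \<in> {0..1}" "\<bar>s - t\<bar> < d" for s t z
    using d(2)[of "(t, z)" "(s, z)"] that by (auto simp: dist_Pair_Pair dist_norm)
  obtain n :: nat where n: "n > 0" "1 / n < d"
    using reals_Archimedean[OF d(1)] by (metis inverse_eq_divide zero_less_Suc)
  have cont: "continuous_on {0..1} (\<lambda>t. \<phi> t z)" if "z \<in> K" for z
  proof -
    have "continuous_on {0..1} (\<lambda>t. (\<lambda>(t, z). \<phi> t z) (t, z))"
      using that by (intro continuous_on_compose2[OF assms(2)] continuous_intros) auto
    then show ?thesis
      by simp
  qed
  have "norm (integral {0..1} (\<lambda>t. \<phi> t z) - (\<Sum>k<n. (1 / n) *\<^sub>R \<phi> (k / n) z)) \<le> e"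
    if z: "z \<in> K" for z
  proof -
    \<comment> \<open>The error accumulates by at most \<open>e / n\<close> per subinterval, on
      which the integrand stays within \<open>e\<close> of its value at the left endpoint. Induction
      on \<open>m\<close> with this linear bound yields \<open>e\<close> at
      \<open>m = n\<close>.\<close>
    have "norm (integral {0..m / n} (\<lambda>t. \<phi> t z) - (\<Sum>k<m. (1 / n) *\<^sub>R \<phi> (k / n) z)) \<le> m * (e / n)"
      if "m \<le> n" for m :: nat
      using that
    proof (induction m)
      case (Suc m)
      have le: "0 \<le> real m / n" "real m / n \<le> real (Suc m) / n" "real (Suc m) / n \<le> 1"
        using Suc.prems n by (auto simp: divide_simps)
      have len: "real (Suc m) / n - real m / n = 1 / n"
        by (simp add: add_divide_distrib)
      have int: "(\<lambda>t. \<phi> t z) integrable_on {a..b}" if "0 \<le> a" "b \<le> 1" for a b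
        using that by (intro integrable_continuous_real continuous_on_subset[OF cont[OF z]]) auto
      have "norm (integral {m / n..Suc m / n} (\<lambda>t. \<phi> t z - \<phi> (m / n) z)) \<le> e * (Suc m / n - m / n)"
      proof (rule integral_bound)
        show "continuous_on {m / n..Suc m / n} (\<lambda>t. \<phi> t z - \<phi> (m / n) z)"
          using le by (intro continuous_intros continuous_on_subset[OF cont[OF z]]) auto
        fix t assume t: "t \<in> {m / n..Suc m / n}"
        then have "\<bar>t - m / n\<bar> \<le> 1 / n"
          using len by auto
        moreover have "t \<in> {0..1}" "m / n \<in> {0..1}"
          using t le unfolding atLeastAtMost_iff by linarith+
        ultimately show "norm (\<phi> t z - \<phi> (m / n) z) \<le> e"
          using close[OF z] n(2) by (meson order_le_less_trans)
      qed (use le in auto)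
      moreover have "integral {m / n..Suc m / n} (\<lambda>t. \<phi> t z - \<phi> (m / n) z) =
          integral {m / n..Suc m / n} (\<lambda>t. \<phi> t z) - (1 / n) *\<^sub>R \<phi> (m / n) z"
      proof -
        have "integral {m / n..Suc m / n} (\<lambda>t. \<phi> t z - \<phi> (m / n) z) =
            integral {m / n..Suc m / n} (\<lambda>t. \<phi> t z) - integral {m / n..Suc m / n} (\<lambda>t. \<phi> (m / n) z)"
          using le by (intro integral_diff int) auto
        also have "integral {m / n..Suc m / n} (\<lambda>t. \<phi> (m / n) z) = (1 / n) *\<^sub>R \<phi> (m / n) z"
          using le(2) len by (simp only: integral_const_real content_real)
        finally show ?thesis .
      qed
      ultimately have step: "norm (integral {m / n..Suc m / n} (\<lambda>t. \<phi> t z) - (1 / n) *\<^sub>R \<phi> (m / n) z) \<le> e / n"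
        by (simp only: len times_divide_eq_right mult_1_right)
      have split: "integral {0..Suc m / n} (\<lambda>t. \<phi> t z) =
          integral {0..m / n} (\<lambda>t. \<phi> t z) + integral {m / n..Suc m / n} (\<lambda>t. \<phi> t z)"
        using le int[of 0 "Suc m / n"] by (intro Henstock_Kurzweil_Integration.integral_combine[symmetric]) auto
      have IH: "norm (integral {0..m / n} (\<lambda>t. \<phi> t z) - (\<Sum>k<m. (1 / n) *\<^sub>R \<phi> (k / n) z)) \<le> m * (e / n)"
        using Suc by simp
      have "norm (integral {0..Suc m / n} (\<lambda>t. \<phi> t z) - (\<Sum>k<Suc m. (1 / n) *\<^sub>R \<phi> (k / n) z))
            \<le> m * (e / n) + e / n"
        unfolding split sum.lessThan_Suc
        by (rule order_trans[OF norm_diff_triangle_ineq add_mono[OF IH step]])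
      then show ?case
        by (simp add: distrib_right add_divide_distrib add.commute)
    qed auto
    from this[of n] n show ?thesis
      by simp
  qed
  with n(1) show thesis
    by (rule that)
qed

lemma contour_integral_linepath_param:
  "contour_integral (linepath a b) f = integral {0..1} (\<lambda>t. f (linepath a b t) * (b - a))"
  by (simp add: contour_integral_integral)

text \<open>\<open>K\<close> is any set disjoint from the segment because two choices occur later:
  the given compact set, for uniform Riemann sums, and the whole complement of the segment, for
  continuity of the integral in \<open>z\<close>.\<close>

lemma continuous_on_Cauchy_kernel:
  fixes a b :: complex
  assumes "continuous_on (closed_segment a b) g" "closed_segment a b \<inter> K = {}"
  shows "continuous_on ({0..1} \<times> K)
           (\<lambda>(t, z). g (linepath a b t) / (linepath a b t - z) * (b - a))"
proof -
  have g: "continuous_on ({0..1} \<times> K) (\<lambda>x. g (linepath a b (fst x)))"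
    by (rule continuous_on_compose2[OF assms(1)])
       (auto intro!: continuous_intros simp: linepath_def closed_segment_def)
  have line: "continuous_on ({0..1} \<times> K) (\<lambda>x. linepath a b (fst x))"
    unfolding linepath_def by (intro continuous_intros)
  have "linepath a b t \<noteq> z" if "t \<in> {0..1}" "z \<in> K" for t z
    using assms(2) that by (auto simp: linepath_def closed_segment_def)
  then have "\<forall>x\<in>{0..1} \<times> K. linepath a b (fst x) - snd x \<noteq> 0"
    by auto
  from continuous_on_divide[OF g continuous_on_diff[OF line continuous_on_snd[OF continuous_on_id]] this]
  show ?thesis
    unfolding split_beta by (rule continuous_on_mult[OF _ continuous_on_const])
qed

text \<open>A Riemann sum of the parametrised integral is itself a finite sum of simple poles,
  located at points of the segment and hence off \<open>K\<close>.\<close>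

lemma pole_sum_approximable_contour_integral:
  assumes "compact K" "closure D = UNIV"
    and "continuous_on (closed_segment a b) g" "closed_segment a b \<inter> K = {}"
  shows "pole_sum_approximable D K (\<lambda>z. contour_integral (linepath a b) (\<lambda>w. g w / (w - z)))"
proof (rule pole_sum_approximable_limit)
  fix e :: real assume "e > 0"
  \<comment> \<open>The Riemann sum bound is non-strict while a strict one is required, hence half
    of \<open>e\<close>.\<close>
  then have "e / 2 > 0"
    by simp
  define \<phi> where "\<phi> t z = g (linepath a b t) / (linepath a b t - z) * (b - a)" for t z
  obtain n :: nat where n: "n > 0" "\<And>z. z \<in> K \<Longrightarrow>
      norm (integral {0..1} (\<lambda>t. \<phi> t z) - (\<Sum>k<n. (1 / n) *\<^sub>R \<phi> (k / n) z)) \<le> e / 2"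
    using riemann_sum_uniform[of K \<phi>, OF assms(1) _ \<open>e / 2 > 0\<close>]
      continuous_on_Cauchy_kernel[OF assms(3,4)] unfolding \<phi>_def by blast
  have "pole_sum_approximable D K (\<lambda>z. \<Sum>k<n. (1 / n) *\<^sub>R \<phi> (k / n) z)"
  proof (rule pole_sum_approximable_sum)
    fix k assume "k \<in> {..<n}"
    then have "linepath a b (k / n) \<in> closed_segment a b"
      by (auto simp: linepath_def closed_segment_def intro!: exI[of _ "k / n"])
    then have "linepath a b (k / n) \<notin> K"
      using assms(4) by blast
    \<comment> \<open>The coefficient absorbs the mesh width \<open>1 / n\<close> and the velocity
      \<open>b - a\<close>.\<close>
    from pole_sum_approximable_pole[OF assms(1,2) this, of "(1 / n) *\<^sub>R (g (linepath a b (k / n)) * (b - a))"]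
    show "pole_sum_approximable D K (\<lambda>z. (1 / n) *\<^sub>R \<phi> (k / n) z)"
      by (simp add: \<phi>_def scaleR_conv_of_real)
  qed
  moreover have "norm (contour_integral (linepath a b) (\<lambda>w. g w / (w - z)) -
                       (\<Sum>k<n. (1 / n) *\<^sub>R \<phi> (k / n) z)) < e" if "z \<in> K" for z
    using n(2)[OF that] \<open>e > 0\<close> by (simp add: contour_integral_linepath_param \<phi>_def)
  ultimately show "\<exists>h. pole_sum_approximable D K h \<and>
      (\<forall>z\<in>K. norm (contour_integral (linepath a b) (\<lambda>w. g w / (w - z)) - h z) < e)"
    by blast
qed

text \<open>This continuity extends Cauchy's formula from interiors of grid cells to points of
  \<open>K\<close> on grid lines.\<close>

lemma continuous_on_contour_integral_Cauchy_kernel: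
  assumes "continuous_on (closed_segment a b) g"
  shows "continuous_on (- closed_segment a b)
           (\<lambda>z. contour_integral (linepath a b) (\<lambda>w. g w / (w - z)))"
proof -
  have "continuous_on ((- closed_segment a b) \<times> {0..1})
          (\<lambda>x. (\<lambda>(t, z). g (linepath a b t) / (linepath a b t - z) * (b - a)) (snd x, fst x))"
    by (rule continuous_on_compose2[OF continuous_on_Cauchy_kernel[OF assms, of "- closed_segment a b"]])
       (auto intro!: continuous_intros)
  then show ?thesis
    unfolding contour_integral_linepath_param
    using integral_continuous_on_param[of "- closed_segment a b" 0 1
        "\<lambda>z t. g (linepath a b t) / (linepath a b t - z) * (b - a)"]
    by (simp add: split_beta)
qed

section \<open>Square grids and Cauchy's formula near a compact set\<close>

text \<open>Integer indices make passage to a neighbouring cell an injective translation, so that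
  cancellation of shared edges becomes a reindexing of finite sums.\<close>

definition grid_point :: "real \<Rightarrow> int \<times> int \<Rightarrow> complex" where
  "grid_point d x = Complex (d * of_int (fst x)) (d * of_int (snd x))"

abbreviation east :: "int \<times> int \<Rightarrow> int \<times> int" where
  "east x \<equiv> (fst x + 1, snd x)"

abbreviation north :: "int \<times> int \<Rightarrow> int \<times> int" where
  "north x \<equiv> (fst x, snd x + 1)"

definition grid_cell :: "real \<Rightarrow> int \<times> int \<Rightarrow> complex set" where
  "grid_cell d x = cbox (grid_point d x) (grid_point d (north (east x)))"

lemma in_grid_cell_iff:
  "z \<in> grid_cell d x \<longleftrightarrow> d * of_int (fst x) \<le> Re z \<and> Re z \<le> d * (of_int (fst x) + 1) \<and>
     d * of_int (snd x) \<le> Im z \<and> Im z \<le> d * (of_int (snd x) + 1)"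
  by (auto simp: grid_cell_def grid_point_def in_cbox_complex_iff)

lemma in_interior_grid_cell_iff:
  "z \<in> interior (grid_cell d x) \<longleftrightarrow> d * of_int (fst x) < Re z \<and> Re z < d * (of_int (fst x) + 1) \<and>
     d * of_int (snd x) < Im z \<and> Im z < d * (of_int (snd x) + 1)"
  by (auto simp: grid_cell_def grid_point_def interior_cbox in_box_complex_iff)

lemma convex_grid_cell: "convex (grid_cell d x)"
  by (simp add: grid_cell_def)

lemma grid_point_in_grid_cell:
  assumes "d > 0"
  shows "grid_point d x \<in> grid_cell d x" "grid_point d (east x) \<in> grid_cell d x"
    "grid_point d (north x) \<in> grid_cell d x" "grid_point d (north (east x)) \<in> grid_cell d x"
  using assms by (auto simp: in_grid_cell_iff grid_point_def)

lemma grid_segment_subset: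
  assumes "d > 0"
  shows "closed_segment (grid_point d x) (grid_point d (east x)) \<subseteq> grid_cell d x"
    "closed_segment (grid_point d (north x)) (grid_point d (north (east x))) \<subseteq> grid_cell d x"
    "closed_segment (grid_point d x) (grid_point d (north x)) \<subseteq> grid_cell d x"
    "closed_segment (grid_point d (east x)) (grid_point d (north (east x))) \<subseteq> grid_cell d x"
  by (intro closed_segment_subset convex_grid_cell grid_point_in_grid_cell[OF assms])+

text \<open>In each coordinate, overlap of an open with a closed unit interval forces
  \<open>m < n + 1\<close> and \<open>n < m + 1\<close>, hence equality of the integers. Thus an
  interior point of a cell lies on no grid line and in no other closed cell.\<close>

lemma interior_grid_cell_disjoint:
  assumes "d > 0" "z \<in> interior (grid_cell d x)" "z \<in> grid_cell d y"
  shows "x = y"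
proof -
  have *: "m = n" if "d * of_int m < r" "r < d * (of_int m + 1)" "d * of_int n \<le> r" "r \<le> d * (of_int n + 1)"
    for m n :: int and r :: real
  proof -
    have "d * of_int m < d * of_int (n + 1)" "d * of_int n < d * of_int (m + 1)"
      using that by auto
    then have "m < n + 1" "n < m + 1"
      using assms(1) by (simp_all only: mult_less_cancel_left_pos of_int_less_iff)
    then show ?thesis
      by simp
  qed
  show ?thesis
    using assms(2,3) unfolding in_interior_grid_cell_iff in_grid_cell_iff
    by (intro prod_eqI) (auto intro: *)
qed

lemma grid_cell_cover:
  assumes "d > 0"
  obtains x where "z \<in> grid_cell d x"
proof
  have *: "d * of_int \<lfloor>r / d\<rfloor> \<le> r" "r \<le> d * (of_int \<lfloor>r / d\<rfloor> + 1)" for r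
    using iffD1[OF pos_le_divide_eq[OF assms] of_int_floor_le[of "r / d"]]
      iffD1[OF pos_divide_le_eq[OF assms] real_of_int_floor_add_one_ge[of "r / d"]]
    by (simp_all add: mult.commute)
  show "z \<in> grid_cell d (\<lfloor>Re z / d\<rfloor>, \<lfloor>Im z / d\<rfloor>)"
    by (simp add: in_grid_cell_iff *)
qed

lemma closure_interior_grid_cell:
  assumes "d > 0"
  shows "closure (interior (grid_cell d x)) = grid_cell d x"
proof -
  \<comment> \<open>The centre of the cell witnesses a non-empty interior; a convex set with
    non-empty interior has the same closure as its interior.\<close>
  have "Complex (d * (of_int (fst x) + 1 / 2)) (d * (of_int (snd x) + 1 / 2)) \<in> interior (grid_cell d x)"
    using assms unfolding in_interior_grid_cell_iff by simp
  then have "interior (grid_cell d x) \<noteq> {}"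
    by blast
  then show ?thesis
    using convex_closure_interior[OF convex_grid_cell] by (simp add: grid_cell_def)
qed

lemma dist_grid_cell_le:
  assumes "z \<in> grid_cell d x" "w \<in> grid_cell d x"
  shows "dist z w \<le> 2 * d"
proof -
  have "\<bar>Re z - Re w\<bar> \<le> d" "\<bar>Im z - Im w\<bar> \<le> d"
    using assms unfolding in_grid_cell_iff by (auto simp: algebra_simps)
  then show ?thesis
    using cmod_le[of "z - w"] by (simp add: dist_norm)
qed

lemma finite_grid_cells_meeting:
  assumes "bounded K" "d > 0"
  shows "finite {x. grid_cell d x \<inter> K \<noteq> {}}"
proof -
  obtain B where B: "\<And>z. z \<in> K \<Longrightarrow> norm z \<le> B"
    using assms(1) unfolding bounded_iff by blast
  \<comment> \<open>The lower bound has an extra 1 because it is the far side of the cell, with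
    index \<open>m + 1\<close>, that is known to be at least \<open>- B / d\<close>.\<close>
  have range: "m \<in> {- \<lceil>B / d\<rceil> - 1..\<lceil>B / d\<rceil>}"
    if "\<bar>r\<bar> \<le> B" "d * of_int m \<le> r" "r \<le> d * (of_int m + 1)" for m :: int and r :: real
  proof -
    have "d * of_int m \<le> B" "- B \<le> d * (of_int m + 1)"
      using that by linarith+
    then have "of_int m \<le> B / d" "- (B / d) \<le> of_int m + 1"
      using assms(2) by (simp_all add: field_simps)
    then have "of_int m \<le> (of_int \<lceil>B / d\<rceil> :: real)" "- of_int \<lceil>B / d\<rceil> - 1 \<le> (of_int m :: real)"
      using le_of_int_ceiling[of "B / d"] by linarith+
    then show ?thesis
      by simp
  qed
  have "{x. grid_cell d x \<inter> K \<noteq> {}} \<subseteq>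
      {- \<lceil>B / d\<rceil> - 1..\<lceil>B / d\<rceil>} \<times> {- \<lceil>B / d\<rceil> - 1..\<lceil>B / d\<rceil>}"
  proof
    fix x assume "x \<in> {x. grid_cell d x \<inter> K \<noteq> {}}"
    then obtain z where z: "z \<in> grid_cell d x" "z \<in> K"
      by blast
    have "\<bar>Re z\<bar> \<le> B" "\<bar>Im z\<bar> \<le> B"
      using B[OF z(2)] abs_Re_le_cmod[of z] abs_Im_le_cmod[of z] by linarith+
    then have "fst x \<in> {- \<lceil>B / d\<rceil> - 1..\<lceil>B / d\<rceil>}" "snd x \<in> {- \<lceil>B / d\<rceil> - 1..\<lceil>B / d\<rceil>}"
      using z(1) range unfolding in_grid_cell_iff by blast+
    then show "x \<in> {- \<lceil>B / d\<rceil> - 1..\<lceil>B / d\<rceil>} \<times> {- \<lceil>B / d\<rceil> - 1..\<lceil>B / d\<rceil>}"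
      by (cases x) simp
  qed
  then show ?thesis
    by (rule finite_subset) simp
qed

section \<open>Cauchy's formula summed over grid cells\<close>

abbreviation grid_rect :: "real \<Rightarrow> int \<times> int \<Rightarrow> real \<Rightarrow> complex" where
  "grid_rect d x \<equiv> rectpath (grid_point d x) (grid_point d (north (east x)))"

lemma path_image_grid_rect:
  assumes "d > 0"
  shows "path_image (grid_rect d x) = grid_cell d x - interior (grid_cell d x)"
  using assms unfolding grid_cell_def interior_cbox
  by (intro path_image_rectpath_cbox_minus_box) (simp_all add: grid_point_def)

abbreviation edge_integral :: "real \<Rightarrow> (complex \<Rightarrow> complex) \<Rightarrow> int \<times> int \<Rightarrow> int \<times> int \<Rightarrow> complex" where
  "edge_integral d f x y \<equiv> contour_integral (linepath (grid_point d x) (grid_point d y)) f"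

text \<open>The top and left sides of the counterclockwise rectangle are reversed, so that all edge
  integrals run east or north. Opposite sides then pair into terms \<open>h x - h (s x)\<close> with
  \<open>s\<close> a unit translation, ready for telescoping over cells.\<close>

lemma contour_integral_grid_rect:
  assumes "d > 0" "continuous_on (path_image (grid_rect d x)) f"
  shows "contour_integral (grid_rect d x) f =
    edge_integral d f x (east x) - edge_integral d f (north x) (east (north x)) -
    (edge_integral d f x (north x) - edge_integral d f (east x) (north (east x)))"
proof -
  define a b c e where "a = grid_point d x" and "b = grid_point d (east x)"
    and "c = grid_point d (north (east x))" and "e = grid_point d (north x)"
  have rect: "grid_rect d x = linepath a b +++ linepath b c +++ linepath c e +++ linepath e a"
    by (simp add: rectpath_def Let_def a_def b_def c_def e_def grid_point_def)
  have image: "path_image (grid_rect d x) =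
      closed_segment a b \<union> closed_segment b c \<union> closed_segment c e \<union> closed_segment e a"
    unfolding rect by (simp add: path_image_join Un_assoc)
  have cont: "continuous_on (closed_segment a b) f" "continuous_on (closed_segment b c) f"
    "continuous_on (closed_segment c e) f" "continuous_on (closed_segment e a) f"
    using assms(2) unfolding image by (auto elim: continuous_on_subset)
  note int = cont[THEN contour_integrable_continuous_linepath]
  have "contour_integral (grid_rect d x) f =
      contour_integral (linepath a b) f + contour_integral (linepath b c) f +
      contour_integral (linepath c e) f + contour_integral (linepath e a) f"
    unfolding rect using int by (simp add: contour_integral_join contour_integrable_joinI)
  also have "contour_integral (linepath c e) f = - contour_integral (linepath e c) f"
    using cont(3) by (rule contour_integral_reverse_linepath)
  also have "contour_integral (linepath e a) f = - contour_integral (linepath a e) f"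
    using cont(4) by (rule contour_integral_reverse_linepath)
  finally show ?thesis
    by (simp add: a_def b_def c_def e_def)
qed

text \<open>In its own cell \<open>z\<close> has winding number 1. It lies outside every other
  closed cell, where the integrand is therefore holomorphic and Cauchy's theorem gives 0.\<close>

lemma Cauchy_formula_grid_rect:
  assumes "d > 0" "g holomorphic_on grid_cell d y" "z \<in> interior (grid_cell d x)"
  shows "contour_integral (grid_rect d y) (\<lambda>w. g w / (w - z)) =
    (if y = x then 2 * pi * \<i> * g z else 0)"
proof (cases "y = x")
  case True
  have "z \<notin> path_image (grid_rect d x)"
    using assms(3) path_image_grid_rect[OF assms(1)] by blast
  moreover have "winding_number (grid_rect d x) z = 1"
    using assms(3) unfolding grid_cell_def interior_cbox by (rule winding_number_rectpath)
  ultimately have "((\<lambda>w. g w / (w - z)) has_contour_integral (2 * pi * \<i> * 1 * g z)) (grid_rect d x)"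
    using Cauchy_integral_formula_convex_simple[OF convex_grid_cell assms(2)[unfolded True] assms(3), of "grid_rect d x"]
      path_image_grid_rect[OF assms(1), of x] by auto
  then show ?thesis
    using True by (simp add: contour_integral_unique)
next
  case False
  then have "z \<notin> grid_cell d y"
    using interior_grid_cell_disjoint[OF assms(1,3)] by blast
  then have "(\<lambda>w. g w / (w - z)) holomorphic_on grid_cell d y"
    using assms(2) by (auto intro!: holomorphic_intros)
  then have "((\<lambda>w. g w / (w - z)) has_contour_integral 0) (grid_rect d y)"
    using path_image_grid_rect[OF assms(1), of y]
    by (intro Cauchy_theorem_convex_simple[OF _ convex_grid_cell]) auto
  then show ?thesis
    using False by (simp add: contour_integral_unique)
qed

text \<open>
  With \<open>S\<close> a set of cells and \<open>s\<close> a unit translation, the surviving terms belong to edges having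
  exactly one of their two adjacent cells in \<open>S\<close>.
\<close>

lemma sum_diff_shift:
  fixes h :: "'a \<Rightarrow> 'b::ab_group_add"
  assumes "finite S" "inj s"
  shows "(\<Sum>x\<in>S. h x - h (s x)) = sum h (S - s ` S) - sum h (s ` S - S)"
proof -
  have "(\<Sum>x\<in>S. h (s x)) = sum h (s ` S)"
    using assms(2) by (simp add: sum.reindex inj_on_subset)
  moreover have "sum h S = sum h (S \<inter> s ` S) + sum h (S - s ` S)"
    "sum h (s ` S) = sum h (S \<inter> s ` S) + sum h (s ` S - S)"
    using sum.Int_Diff[of S h "s ` S"] sum.Int_Diff[of "s ` S" h S] assms(1) by (simp_all add: Int_commute)
  ultimately show ?thesis
    by (simp add: sum_subtractf)
qed

text \<open>An edge that survives the summation separates a cell meeting \<open>K\<close> from a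
  cell missing \<open>K\<close>. The first cell lies in \<open>U\<close> and the second avoids
  \<open>K\<close>, so the edge lies in \<open>U - K\<close>. One list \<open>E\<close> serves all
  \<open>g\<close> and \<open>z\<close>.\<close>

lemma Cauchy_formula_compact:
  assumes "compact K" "open U" "K \<subseteq> U"
  obtains E :: "(complex \<times> complex) list"
  where "\<forall>(a, b)\<in>set E. closed_segment a b \<subseteq> U - K"
    and "\<forall>g z. g holomorphic_on U \<longrightarrow> z \<in> K \<longrightarrow>
      (\<Sum>(a, b)\<leftarrow>E. contour_integral (linepath a b) (\<lambda>w. g w / (w - z))) = 2 * pi * \<i> * g z"
proof -
  obtain d' where d': "d' > 0" "\<And>z w. z \<in> K \<Longrightarrow> w \<in> - U \<Longrightarrow> d' \<le> dist z w"
    using separate_compact_closed[OF assms(1), of "- U"] assms by blast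
  \<comment> \<open>Cells have diameter at most \<open>2 * d\<close>, which is less than
    \<open>d'\<close>, so a cell meeting \<open>K\<close> cannot leave \<open>U\<close>.\<close>
  define d where "d = d' / 3"
  have d: "d > 0" "2 * d < d'"
    using d'(1) by (simp_all add: d_def)
  define S where "S = {x. grid_cell d x \<inter> K \<noteq> {}}"
  have "finite S"
    unfolding S_def using assms(1) d(1) by (intro finite_grid_cells_meeting compact_imp_bounded)
  have cell_U: "grid_cell d x \<subseteq> U" if x: "x \<in> S" for x
  proof
    fix w assume w: "w \<in> grid_cell d x"
    obtain z where z: "z \<in> K" "z \<in> grid_cell d x"
      using x unfolding S_def by blast
    have "dist z w < d'"
      using dist_grid_cell_le[OF z(2) w] d(2) by simp
    then show "w \<in> U"
      using d'(2)[OF z(1), of w] by force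
  qed
  have cell_K: "grid_cell d x \<inter> K = {}" if "x \<notin> S" for x
    using that unfolding S_def by blast
  define edge where "edge s x = (grid_point d x, grid_point d (s x))" for s :: "int \<times> int \<Rightarrow> int \<times> int" and x
  \<comment> \<open>A horizontal edge is labelled by the cell above it, a vertical edge by the cell
    to its right. The surviving edges have their only adjacent cell of \<open>S\<close> above
    (\<open>X1\<close>), below (\<open>X2\<close>), to the right (\<open>Y1\<close>) or to the left
    (\<open>Y2\<close>).\<close>
  define X1 X2 Y1 Y2 where "X1 = S - north ` S" and "X2 = north ` S - S"
    and "Y1 = S - east ` S" and "Y2 = east ` S - S"
  have fin: "finite X1" "finite X2" "finite Y1" "finite Y2"
    using \<open>finite S\<close> by (simp_all add: X1_def X2_def Y1_def Y2_def)
  obtain x1 x2 y1 y2 where lists: "set x1 = X1" "distinct x1" "set x2 = X2" "distinct x2"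
    "set y1 = Y1" "distinct y1" "set y2 = Y2" "distinct y2"
    using fin[THEN finite_distinct_list] by metis
  \<comment> \<open>The families entering with a minus sign, \<open>X2\<close> and
    \<open>Y1\<close>, are traversed backwards, so that \<open>E\<close> is a plain sum of edge
    integrals.\<close>
  define E where "E = map (edge east) x1 @ map (prod.swap \<circ> edge east) x2 @
    map (edge north) y2 @ map (prod.swap \<circ> edge north) y1"
  have horizontal: "closed_segment (grid_point d x) (grid_point d (east x)) \<subseteq> U - K"
    if "x \<in> X1 \<union> X2" for x
  proof -
    \<comment> \<open>The cell below \<open>x\<close>, whose top side is the bottom side of
      \<open>x\<close>.\<close>
    define y where "y = (fst x, snd x - 1)"
    have sub: "closed_segment (grid_point d x) (grid_point d (east x)) \<subseteq> grid_cell d x \<inter> grid_cell d y"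
      using grid_segment_subset(1)[OF d(1), of x] grid_segment_subset(2)[OF d(1), of y]
      by (simp add: y_def)
    have "x \<in> north ` S \<longleftrightarrow> y \<in> S"
      by (auto simp: y_def image_iff intro!: bexI[of _ y])
    with that have "x \<in> S \<and> y \<notin> S \<or> y \<in> S \<and> x \<notin> S"
      unfolding X1_def X2_def by blast
    then show ?thesis
      using sub cell_U cell_K by blast
  qed
  have vertical: "closed_segment (grid_point d x) (grid_point d (north x)) \<subseteq> U - K"
    if "x \<in> Y1 \<union> Y2" for x
  proof -
    define y where "y = (fst x - 1, snd x)"
    have sub: "closed_segment (grid_point d x) (grid_point d (north x)) \<subseteq> grid_cell d x \<inter> grid_cell d y"
      using grid_segment_subset(3)[OF d(1), of x] grid_segment_subset(4)[OF d(1), of y]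
      by (simp add: y_def)
    have "x \<in> east ` S \<longleftrightarrow> y \<in> S"
      by (auto simp: y_def image_iff intro!: bexI[of _ y])
    with that have "x \<in> S \<and> y \<notin> S \<or> y \<in> S \<and> x \<notin> S"
      unfolding Y1_def Y2_def by blast
    then show ?thesis
      using sub cell_U cell_K by blast
  qed
  have E_sub: "closed_segment a b \<subseteq> U - K" if "(a, b) \<in> set E" for a b
  proof -
    have "(a, b) \<in> edge east ` X1 \<union> (prod.swap \<circ> edge east) ` X2 \<union>
        (edge north ` Y2 \<union> (prod.swap \<circ> edge north) ` Y1)"
      using that unfolding E_def set_append set_map lists by blast
    then show ?thesis
    proof (elim UnE imageE)
      fix x assume "x \<in> X1" "(a, b) = edge east x"
      then show ?thesis
        using horizontal[of x] by (simp add: edge_def)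
    next
      fix x assume "x \<in> X2" "(a, b) = (prod.swap \<circ> edge east) x"
      then show ?thesis
        unfolding closed_segment_commute[of a b] using horizontal[of x] by (simp add: edge_def)
    next
      fix x assume "x \<in> Y2" "(a, b) = edge north x"
      then show ?thesis
        using vertical[of x] by (simp add: edge_def)
    next
      fix x assume "x \<in> Y1" "(a, b) = (prod.swap \<circ> edge north) x"
      then show ?thesis
        unfolding closed_segment_commute[of a b] using vertical[of x] by (simp add: edge_def)
    qed
  qed
  \<comment> \<open>First the case of \<open>z\<close> interior to a cell, where no grid edge passes
    through \<open>z\<close> and all edge integrals make sense.\<close>
  have formula: "(\<Sum>(a, b)\<leftarrow>E. contour_integral (linepath a b) (\<lambda>w. g w / (w - z))) = 2 * pi * \<i> * g z"
    if g: "g holomorphic_on U" and x: "x \<in> S" "z \<in> interior (grid_cell d x)" for g x z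
  proof -
    define f where "f w = g w / (w - z)" for w
    define h v where "h y = edge_integral d f y (east y)" and "v y = edge_integral d f y (north y)" for y
    \<comment> \<open>All cells \<open>y\<close> are covered, not only those in \<open>S\<close>,
      since the labels in \<open>X2\<close> and \<open>Y2\<close> lie outside
      \<open>S\<close>.\<close>
    have off: "z \<notin> path_image (grid_rect d y)" for y
      using interior_grid_cell_disjoint[OF d(1) x(2), of y] x(2) path_image_grid_rect[OF d(1), of y] by auto
    have cont: "continuous_on (A - {z}) f" if "A \<subseteq> U" for A
      unfolding f_def using holomorphic_on_imp_continuous_on[OF g] that
      by (auto intro!: continuous_intros elim: continuous_on_subset)
    have edge_cont: "continuous_on (closed_segment a b) f" if "z \<notin> closed_segment a b" "closed_segment a b \<subseteq> U" for a b
      using cont[OF that(2)] that(1) by simp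
    have rect: "contour_integral (grid_rect d y) f = h y - h (north y) - (v y - v (east y))" if "y \<in> S" for y
    proof -
      have "path_image (grid_rect d y) \<subseteq> U"
        using path_image_grid_rect[OF d(1), of y] cell_U[OF that] by blast
      then have "continuous_on (path_image (grid_rect d y)) f"
        using cont[of "path_image (grid_rect d y)"] off[of y] by simp
      from contour_integral_grid_rect[OF d(1) this] show ?thesis
        by (simp add: h_def v_def)
    qed
    have "2 * pi * \<i> * g z = (\<Sum>y\<in>S. if y = x then 2 * pi * \<i> * g z else 0)"
      using \<open>finite S\<close> x(1) by simp
    also have "\<dots> = (\<Sum>y\<in>S. contour_integral (grid_rect d y) f)"
      using Cauchy_formula_grid_rect[OF d(1) holomorphic_on_subset[OF g cell_U] x(2)]
      by (intro sum.cong) (simp_all add: f_def[abs_def])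
    also have "\<dots> = (\<Sum>y\<in>S. h y - h (north y)) - (\<Sum>y\<in>S. v y - v (east y))"
      unfolding sum_subtractf[symmetric] by (intro sum.cong refl rect)
    also have "(\<Sum>y\<in>S. h y - h (north y)) = sum h X1 - sum h X2"
      unfolding X1_def X2_def using \<open>finite S\<close> by (intro sum_diff_shift) (auto intro!: injI prod_eqI)
    also have "(\<Sum>y\<in>S. v y - v (east y)) = sum v Y1 - sum v Y2"
      unfolding Y1_def Y2_def using \<open>finite S\<close> by (intro sum_diff_shift) (auto intro!: injI prod_eqI)
    finally have total: "2 * pi * \<i> * g z = sum h X1 - sum h X2 - (sum v Y1 - sum v Y2)" .
    have off_h: "z \<notin> closed_segment (grid_point d y) (grid_point d (east y))" for y
      using off[of y] by (simp add: rectpath_def Let_def path_image_join grid_point_def)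
    have off_v: "z \<notin> closed_segment (grid_point d y) (grid_point d (north y))" for y
      using off[of y] by (simp add: rectpath_def Let_def path_image_join grid_point_def closed_segment_commute)
    have swap_h: "contour_integral (linepath (grid_point d (east y)) (grid_point d y)) f = - h y" if "y \<in> X2" for y
      unfolding h_def using off_h[of y] horizontal[of y] that
      by (intro contour_integral_reverse_linepath edge_cont) (auto simp: closed_segment_commute)
    have swap_v: "contour_integral (linepath (grid_point d (north y)) (grid_point d y)) f = - v y" if "y \<in> Y1" for y
      unfolding v_def using off_v[of y] vertical[of y] that
      by (intro contour_integral_reverse_linepath edge_cont) (auto simp: closed_segment_commute)
    have "(\<Sum>(a, b)\<leftarrow>E. contour_integral (linepath a b) f) =
        (\<Sum>y\<in>X1. h y) + (\<Sum>y\<in>X2. - h y) + (\<Sum>y\<in>Y2. v y) + (\<Sum>y\<in>Y1. - v y)"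
      using lists swap_h swap_v
      by (simp add: E_def edge_def o_def sum_list_distinct_conv_sum_set h_def v_def)
    also have "\<dots> = 2 * pi * \<i> * g z"
      unfolding total by (simp add: sum_negf)
    finally show ?thesis
      unfolding f_def[abs_def] .
  qed
  \<comment> \<open>A point of \<open>K\<close> lying on a grid line is reached by continuity from the interior of a cell.\<close>
  have "(\<Sum>(a, b)\<leftarrow>E. contour_integral (linepath a b) (\<lambda>w. g w / (w - z))) = 2 * pi * \<i> * g z"
    if g: "g holomorphic_on U" and z: "z \<in> K" for g z
  proof -
    define F where "F z = (\<Sum>(a, b)\<leftarrow>E. contour_integral (linepath a b) (\<lambda>w. g w / (w - z)))" for z
    \<comment> \<open>Only the edges in \<open>E\<close> are removed. They avoid \<open>K\<close>,
      so \<open>W\<close> is an open neighbourhood of \<open>K\<close> even where other grid lines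
      cross it.\<close>
    define W where "W = U - (\<Union>(a, b)\<in>set E. closed_segment a b)"
    have "open W"
      unfolding W_def using assms(2) by (intro open_Diff closed_UN) auto
    have "z \<in> W"
      using E_sub z assms(3) unfolding W_def by blast
    obtain x where x: "z \<in> grid_cell d x"
      using grid_cell_cover[OF d(1)] .
    then have "x \<in> S"
      using z unfolding S_def by blast
    \<comment> \<open>The approximating points stay in the interior of one fixed cell
      \<open>x\<close> of \<open>S\<close>, as \<open>formula\<close> demands.\<close>
    have "z \<in> closure (W \<inter> interior (grid_cell d x))"
      using open_Int_closure_subset[OF \<open>open W\<close>, of "interior (grid_cell d x)"] \<open>z \<in> W\<close> x
      by (auto simp: closure_interior_grid_cell[OF d(1)])
    then obtain zs where zs: "\<And>n. zs n \<in> W \<inter> interior (grid_cell d x)" "zs \<longlonglongrightarrow> z"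
      unfolding closure_sequential by blast
    have gU: "continuous_on U g"
      using g by (rule holomorphic_on_imp_continuous_on)
    have "continuous_on W (\<lambda>z. case p of (a, b) \<Rightarrow> contour_integral (linepath a b) (\<lambda>w. g w / (w - z)))"
      if p: "p \<in> set E" for p
    proof (cases p)
      case (Pair a b)
      then have ab: "(a, b) \<in> set E"
        using p by simp
      then have "closed_segment a b \<subseteq> U" and W: "W \<subseteq> - closed_segment a b"
        using E_sub[OF ab] unfolding W_def by blast+
      then have "continuous_on (closed_segment a b) g"
        using continuous_on_subset[OF gU] by blast
      from continuous_on_subset[OF continuous_on_contour_integral_Cauchy_kernel[OF this] W]
      show ?thesis
        unfolding Pair prod.case .
    qed
    then have cont: "continuous_on W (\<lambda>z. \<Sum>p\<leftarrow>ps. case p of (a, b) \<Rightarrow> contour_integral (linepath a b) (\<lambda>w. g w / (w - z)))"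
      if "set ps \<subseteq> set E" for ps
      using that by (induction ps) (simp_all add: continuous_on_add)
    have "continuous_on W F"
      unfolding F_def by (rule cont) simp
    then have "(\<lambda>n. F (zs n)) \<longlonglongrightarrow> F z"
      using zs \<open>z \<in> W\<close> by (intro continuous_on_tendsto_compose[of W F]) auto
    moreover have "F (zs n) = 2 * pi * \<i> * g (zs n)" for n
      unfolding F_def using zs(1)[of n] by (intro formula[OF g \<open>x \<in> S\<close>]) blast
    ultimately have "(\<lambda>n. 2 * pi * \<i> * g (zs n)) \<longlonglongrightarrow> F z"
      by (simp only:)
    moreover have "(\<lambda>n. 2 * pi * \<i> * g (zs n)) \<longlonglongrightarrow> 2 * pi * \<i> * g z"
      using zs \<open>z \<in> W\<close> by (intro tendsto_intros continuous_on_tendsto_compose[OF gU]) (auto simp: W_def)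
    ultimately show ?thesis
      unfolding F_def[symmetric] by (rule LIMSEQ_unique)
  qed
  moreover have "\<forall>(a, b)\<in>set E. closed_segment a b \<subseteq> U - K"
    using E_sub by blast
  ultimately show thesis
    by (intro that[of E] allI impI)
qed

section \<open>Runge approximation and measurable selection\<close>

theorem Runge_pole_sum_approximable:
  assumes "compact K" "open U" "K \<subseteq> U" "g holomorphic_on U" "closure D = UNIV"
  shows "pole_sum_approximable D K g"
proof -
  obtain E :: "(complex \<times> complex) list" where E:
    "\<forall>(a, b)\<in>set E. closed_segment a b \<subseteq> U - K"
    "\<forall>g z. g holomorphic_on U \<longrightarrow> z \<in> K \<longrightarrow>
      (\<Sum>(a, b)\<leftarrow>E. contour_integral (linepath a b) (\<lambda>w. g w / (w - z))) = 2 * pi * \<i> * g z"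
    by (rule Cauchy_formula_compact[OF assms(1-3)])
  \<comment> \<open>Normalising \<open>g\<close> beforehand avoids rescaling the approximants, whose
    coefficients are confined to \<open>D\<close>.\<close>
  define G where "G w = g w / (2 * pi * \<i>)" for w
  have G: "G holomorphic_on U"
    unfolding G_def using assms(4) by (intro holomorphic_intros) auto
  have "pole_sum_approximable D K
      (\<lambda>z. \<Sum>p\<leftarrow>E. contour_integral (linepath (fst p) (snd p)) (\<lambda>w. G w / (w - z)))"
  proof (rule pole_sum_approximable_sum_list)
    fix p assume "p \<in> set E"
    then have p: "closed_segment (fst p) (snd p) \<subseteq> U - K"
      using E(1) unfolding split_beta by blast
    then have "continuous_on (closed_segment (fst p) (snd p)) G"
      using holomorphic_on_imp_continuous_on[OF G] by (auto elim: continuous_on_subset)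
    with p show "pole_sum_approximable D K
        (\<lambda>z. contour_integral (linepath (fst p) (snd p)) (\<lambda>w. G w / (w - z)))"
      by (intro pole_sum_approximable_contour_integral[OF assms(1,5)]) auto
  qed
  moreover have "(\<Sum>p\<leftarrow>E. contour_integral (linepath (fst p) (snd p)) (\<lambda>w. G w / (w - z))) = g z"
    if "z \<in> K" for z
    using E(2)[rule_format, OF G that] by (simp add: case_prod_unfold G_def)
  ultimately show ?thesis
    unfolding pole_sum_approximable_def by simp
qed

section \<open>Countable density and measurable selection\<close>

lemma countable_closure_UNIV:
  obtains D :: "'a::second_countable_topology set" where "countable D" "closure D = UNIV"
proof -
  obtain D :: "'a set" where D: "countable D" "\<forall>X. open X \<longrightarrow> X \<noteq> {} \<longrightarrow> (\<exists>d\<in>D. d \<in> X)"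
    using countable_dense_exists[where 'a = 'a] by (elim exE conjE)
  have "- closure D = {}"
    using D(2)[rule_format, of "- closure D"] closure_subset[of D] by blast
  then show thesis
    using that D(1) by blast
qed

text \<open>The non-strict inequality passes to limits, hence from a countable dense subset to all
  of \<open>K\<close>. The event is thereby a countable intersection of measurable sets.\<close>

lemma pred_uniformly_close:
  fixes f :: "'w \<Rightarrow> complex \<Rightarrow> complex"
  assumes "\<And>z. z \<in> K \<Longrightarrow> (\<lambda>\<omega>. f \<omega> z) \<in> borel_measurable M"
    and "\<And>\<omega>. \<omega> \<in> space M \<Longrightarrow> continuous_on K (f \<omega>)" and "continuous_on K q"
  shows "Measurable.pred M (\<lambda>\<omega>. \<forall>z\<in>K. norm (f \<omega> z - q z) \<le> e)"
proof -
  obtain T where T: "countable T" "T \<subseteq> K" "K \<subseteq> closure T"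
    using separable[of K] by metis
  have dense: "(\<forall>z\<in>K. norm (f \<omega> z - q z) \<le> e) \<longleftrightarrow> (\<forall>z\<in>T. norm (f \<omega> z - q z) \<le> e)"
    if \<omega>: "\<omega> \<in> space M" for \<omega>
  proof
    assume le: "\<forall>z\<in>T. norm (f \<omega> z - q z) \<le> e"
    show "\<forall>z\<in>K. norm (f \<omega> z - q z) \<le> e"
    proof
      fix z assume z: "z \<in> K"
      then obtain t where t: "\<And>n. t n \<in> T" "t \<longlonglongrightarrow> z"
        using T(3) closure_sequential[of z T] by blast
      have "t n \<in> K" for n
        using t(1) T(2) by blast
      moreover have "continuous_on K (\<lambda>z. norm (f \<omega> z - q z))"
        using assms(2)[OF \<omega>] assms(3) by (intro continuous_intros)
      ultimately have "(\<lambda>n. norm (f \<omega> (t n) - q (t n))) \<longlonglongrightarrow> norm (f \<omega> z - q z)"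
        using t(2) z by (intro continuous_on_tendsto_compose[of K "\<lambda>z. norm (f \<omega> z - q z)"]) auto
      then show "norm (f \<omega> z - q z) \<le> e"
        using le t(1) by (intro LIMSEQ_le_const2) auto
    qed
  qed (use T(2) in blast)
  have "Measurable.pred M (\<lambda>\<omega>. \<forall>z\<in>T. norm (f \<omega> z - q z) \<le> e)"
    unfolding pred_def
  proof (rule sets.sets_Collect_countable_All')
    fix z assume "z \<in> T"
    then have [measurable]: "(\<lambda>\<omega>. f \<omega> z) \<in> borel_measurable M"
      using T(2) assms(1) by blast
    show "{\<omega> \<in> space M. norm (f \<omega> z - q z) \<le> e} \<in> sets M"
      by measurable
  qed (rule T(1))
  with measurable_cong[OF dense] show ?thesis
    by (rule iffD2)
qed

lemma measurable_uniform_approximation: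
  fixes f :: "'w \<Rightarrow> complex \<Rightarrow> complex" and q :: "nat \<Rightarrow> complex \<Rightarrow> complex"
  assumes meas: "\<And>z. z \<in> K \<Longrightarrow> (\<lambda>\<omega>. f \<omega> z) \<in> borel_measurable M"
    and cont: "\<And>\<omega>. \<omega> \<in> space M \<Longrightarrow> continuous_on K (f \<omega>)" "\<And>k. continuous_on K (q k)"
    and approx: "\<And>\<omega> e. \<omega> \<in> space M \<Longrightarrow> e > 0 \<Longrightarrow> \<exists>k. \<forall>z\<in>K. norm (f \<omega> z - q k z) \<le> e"
  shows "\<exists>N :: nat \<Rightarrow> 'w \<Rightarrow> nat. (\<forall>j. N j \<in> measurable M (count_space UNIV)) \<and>
    (\<forall>\<omega>\<in>space M. uniform_limit K (\<lambda>j. q (N j \<omega>)) (f \<omega>) sequentially)"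
proof -
  \<comment> \<open>Taking the least admissible index makes the choice measurable: it equals
    \<open>k\<close> when the event for \<open>k\<close> occurs and those for smaller indices
    fail.\<close>
  define N where "N j \<omega> = (LEAST k. \<forall>z\<in>K. norm (f \<omega> z - q k z) \<le> inverse (real (Suc j)))" for j \<omega>
  have N_meas: "N j \<in> measurable M (count_space UNIV)" for j
    unfolding N_def by (intro measurable_Least pred_uniformly_close meas cont)
  have N_close: "norm (f \<omega> z - q (N j \<omega>) z) \<le> inverse (real (Suc j))" if \<omega>: "\<omega> \<in> space M" and z: "z \<in> K" for j \<omega> z
  proof -
    have "inverse (real (Suc j)) > 0"
      by simp
    from approx[OF \<omega> this] obtain k where "\<forall>z\<in>K. norm (f \<omega> z - q k z) \<le> inverse (real (Suc j))"
      by (rule exE)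
    then have "\<forall>z\<in>K. norm (f \<omega> z - q (N j \<omega>) z) \<le> inverse (real (Suc j))"
      unfolding N_def
      by (rule LeastI[where P = "\<lambda>k. \<forall>z\<in>K. norm (f \<omega> z - q k z) \<le> inverse (real (Suc j))"])
    then show ?thesis
      using z by (rule bspec)
  qed
  show ?thesis
  proof (intro exI[of _ N] conjI allI ballI)
    show "N j \<in> measurable M (count_space UNIV)" for j
      by (rule N_meas)
    fix \<omega> assume \<omega>: "\<omega> \<in> space M"
    show "uniform_limit K (\<lambda>j. q (N j \<omega>)) (f \<omega>) sequentially"
    proof (rule uniform_limitI)
      fix e :: real assume "e > 0"
      with LIMSEQ_inverse_real_of_nat have "\<forall>\<^sub>F j in sequentially. inverse (real (Suc j)) < e"
        by (rule order_tendstoD(2))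
      then show "\<forall>\<^sub>F j in sequentially. \<forall>z\<in>K. dist (q (N j \<omega>) z) (f \<omega> z) < e"
      proof (rule eventually_mono, intro ballI)
        fix j z assume less: "inverse (real (Suc j)) < e" and z: "z \<in> K"
        have "dist (q (N j \<omega>) z) (f \<omega> z) = norm (f \<omega> z - q (N j \<omega>) z)"
          unfolding dist_norm by (rule norm_minus_commute)
        also note N_close[OF \<omega> z]
        also note less
        finally show "dist (q (N j \<omega>) z) (f \<omega> z) < e" .
      qed
    qed
  qed
qed

text \<open>A single sequence serves every \<open>U\<close> and \<open>g\<close>. As it does not
  depend on the sample point, choosing an approximant reduces to choosing an index.\<close>

lemma countable_pole_free_Runge:
  assumes "compact K" "K \<noteq> {}"
  shows "\<exists>q :: nat \<Rightarrow> complex \<Rightarrow> complex.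
    (\<forall>k. rational_pole_free_on K (q k) \<and> continuous_on K (q k)) \<and>
    (\<forall>U g e. open U \<longrightarrow> K \<subseteq> U \<longrightarrow> g holomorphic_on U \<longrightarrow> e > 0 \<longrightarrow>
      (\<exists>k. \<forall>z\<in>K. norm (g z - q k z) \<le> e))"
proof -
  obtain D :: "complex set" where D: "countable D" "closure D = UNIV"
    by (rule countable_closure_UNIV)
  define P where "P = lists (D \<times> (D - K))"
  have "countable P"
    unfolding P_def using D(1) by (intro countable_lists countable_SIGMA countable_Diff)
  \<comment> \<open>Non-emptiness, witnessed by the empty list, ensures that every value of
    \<open>from_nat_into P\<close> belongs to \<open>P\<close>.\<close>
  have "P \<noteq> {}"
    unfolding P_def using lists.Nil by blast
  have P_sub: "P \<subseteq> lists (UNIV \<times> (- K))"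
    unfolding P_def by (intro lists_mono) blast
  define q where "q k = pole_sum (from_nat_into P k)" for k
  have q_mem: "from_nat_into P k \<in> lists (UNIV \<times> (- K))" for k
    using from_nat_into[OF \<open>P \<noteq> {}\<close>] P_sub by (rule rev_subsetD)
  have q_rational: "rational_pole_free_on K (q k)" and q_cont: "continuous_on K (q k)" for k
    unfolding q_def by (rule pole_sum_pole_free[OF assms(2) q_mem] continuous_on_pole_sum[OF q_mem])+
  have "\<exists>k. \<forall>z\<in>K. norm (g z - q k z) \<le> e"
    if U: "open U" "K \<subseteq> U" "g holomorphic_on U" and e: "e > 0" for U g e
  proof -
    have "pole_sum_approximable D K g"
      using assms(1) U D(2) by (rule Runge_pole_sum_approximable)
    then obtain xs where xs: "xs \<in> P" "\<forall>z\<in>K. norm (g z - pole_sum xs z) < e"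
      using e unfolding pole_sum_approximable_def P_def by blast
    obtain k where "from_nat_into P k = xs"
      using from_nat_into_surj[OF \<open>countable P\<close> xs(1)] by blast
    then show ?thesis
      using xs(2) by (intro exI[of _ k]) (simp add: q_def less_imp_le)
  qed
  then show ?thesis
    using q_rational q_cont by (intro exI[of _ q] conjI allI impI)
qed

theorem theorem2p4:
  fixes M :: "'w measure" and K :: "complex set" and f :: "'w \<Rightarrow> complex \<Rightarrow> complex"
  assumes "compact K" and "K \<noteq> {}"
    and "random_function M K f"
    and "\<And>\<omega>. \<omega> \<in> space M \<Longrightarrow>
           \<exists>U g. open U \<and> K \<subseteq> U \<and> g holomorphic_on U \<and> (\<forall>z\<in>K. g z = f \<omega> z)"
  shows "\<exists>r :: nat \<Rightarrow> 'w \<Rightarrow> complex \<Rightarrow> complex.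
           (\<forall>j. random_rational_function_pole_free M K (r j)) \<and>
           (\<forall>\<omega>\<in>space M. uniform_limit K (\<lambda>j. r j \<omega>) (f \<omega>) sequentially)"
proof -
  obtain q :: "nat \<Rightarrow> complex \<Rightarrow> complex"
    where q: "\<forall>k. rational_pole_free_on K (q k) \<and> continuous_on K (q k)"
    and dense: "\<forall>U g e. open U \<longrightarrow> K \<subseteq> U \<longrightarrow> g holomorphic_on U \<longrightarrow> e > 0 \<longrightarrow>
      (\<exists>k. \<forall>z\<in>K. norm (g z - q k z) \<le> e)"
    using countable_pole_free_Runge[OF assms(1,2)] by (elim exE conjE)
  have "\<exists>N :: nat \<Rightarrow> 'w \<Rightarrow> nat. (\<forall>j. N j \<in> measurable M (count_space UNIV)) \<and>
    (\<forall>\<omega>\<in>space M. uniform_limit K (\<lambda>j. q (N j \<omega>)) (f \<omega>) sequentially)"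
  proof (rule measurable_uniform_approximation)
    show "(\<lambda>\<omega>. f \<omega> z) \<in> borel_measurable M" if "z \<in> K" for z
      using assms(3) that unfolding random_function_def by blast
    show "continuous_on K (q k)" for k
      using q by blast
    fix \<omega> assume "\<omega> \<in> space M"
    then obtain U g where U: "open U" "K \<subseteq> U" "g holomorphic_on U" and g: "\<forall>z\<in>K. g z = f \<omega> z"
      using assms(4) by blast
    have "continuous_on K g"
      using continuous_on_subset[OF holomorphic_on_imp_continuous_on[OF U(3)] U(2)] .
    then show "continuous_on K (f \<omega>)"
      using g by (simp cong: continuous_on_cong)
    show "\<exists>k. \<forall>z\<in>K. norm (f \<omega> z - q k z) \<le> e" if "e > 0" for e
      using dense[rule_format, OF U that] g by simp
  qed
  then obtain N :: "nat \<Rightarrow> 'w \<Rightarrow> nat"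
    where N: "\<And>j. N j \<in> measurable M (count_space UNIV)"
    and lim: "\<forall>\<omega>\<in>space M. uniform_limit K (\<lambda>j. q (N j \<omega>)) (f \<omega>) sequentially"
    by blast
  \<comment> \<open>For fixed \<open>z\<close> this is a function of the index, and every function
    on the discrete space of naturals is measurable.\<close>
  have "(\<lambda>\<omega>. q (N j \<omega>) z) \<in> borel_measurable M" for j z
    using N by (rule measurable_compose) simp
  then have "random_rational_function_pole_free M K (\<lambda>\<omega>. q (N j \<omega>))" for j
    unfolding random_rational_function_pole_free_def random_function_def by (simp add: q)
  with lim show ?thesis
    by (intro exI[of _ "\<lambda>j \<omega>. q (N j \<omega>)"] conjI allI)
qed

end
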